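(* Let $\{(X_k,Y_k)\}_{k\in\mathbb{N}}$ be the sequence generated by the support-set algorithm applied to $\min\{f(X) : X\in\mathcal{O}^{n,p}_+\}$. For any $\epsilon\in(0,1)$, the algorithm reaches an $\epsilon$-approximate first-order stationary point of this problem after at most $O(\epsilon^{-2})$ iterations; that is, there is a constant $C>0$ independent of $\epsilon$ such that for every $\epsilon\in(0,1)$ there is an index $k\le C\epsilon^{-2}$ for which $Y_k$ is an $\epsilon$-approximate first-order stationary point.
   Context: Setting. Let $1<p<n$ be integers, $\mathcal{O}^{n,p} = \{X\in\mathbb{R}^{n\times p} : X^\top X = I_p\}$ and $\mathcal{O}^{n,p}_+ = \{X \in \mathcal{O}^{n,p} : X \ge 0 \text{ entrywise}\}$. The function $f:\mathbb{R}^{n\times p}\to\mathbb{R}$ is continuously differentiable and its Euclidean gradient $\nabla f$ is Lipschitz continuous over $\mathcal{O}^{n,p}$ with constant $L\ge 0$ (Frobenius norm $\|\cdot\|_F$). The problem is $\min\{f(X) : X\in\mathcal{O}^{n,p}_+\}$. Notation. $[X]_{i,j}$, $[X]_{i,:}$, $[X]_{:,j}$ denote the $(i,j)$ entry, $i$-th row, $j$-th column of $X$. $\mathrm{supp}(X)=\{(i,j):[X]_{i,j}\neq 0\}$; $\mathrm{supp}([X]_{:,j})=\{i:[X]_{i,j}\ne 0\}$; $\mathrm{zrow}(X)=\{i : [X]_{i,:}=0\}$. $\mathrm{sign}(X)$ is the entrywise sign matrix; $\mathrm{sign}(\mathcal{O}^{n,p}_+)=\{\mathrm{sign}(X):X\in\mathcal{O}^{n,p}_+\}$.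 $\odot$ is the entrywise product, $\max\{0,\cdot\}$ is entrywise, $\langle A,B\rangle=\mathrm{tr}(A^\top B)$. Approximate stationarity. $\mathrm{grad}\,f(X)=\nabla f(X)-X\,\mathrm{Diag}(X^\top\nabla f(X))$, where $\mathrm{Diag}(B)$ is the diagonal matrix with the same diagonal as $B$. A point $X_*\in\mathcal{O}^{n,p}_+$ is an $\epsilon$-approximate first-order stationary point if $|[\mathrm{grad}\,f(X_* )]_{i,j}|\le\epsilon$ for all $(i,j)\in\mathrm{supp}(X_* )$, and $[\nabla f(X_* )]_{i,j}\ge -\epsilon$ for all $i\in\mathrm{zrow}(X_* )$ and all $j\in\{1,\dots,p\}$. Support-set algorithm. Parameters: $X_0\in\mathcal{O}^{n,p}_+$, $\eta>L$, $\delta\in(0,1)$, $\theta>0$. Put $\bar f_Z(X)=f(Z)+\langle\nabla f(Z),X-Z\rangle+\frac{\eta}{2}\|X-Z\|_F^2$. For $Z\in\mathcal{O}^{n,p}_+$ and $S\in\mathrm{sign}(\mathcal{O}^{n,p}_+)$ let $W=\max\{0,(\eta Z-\nabla f(Z))\odot S\}$ and let $\Pi(Z,S)\in\mathcal{O}^{n,p}_+$ be the matrix whose $j$-th column is $[W]_{:,j}/\|[W]_{:,j}\|_2$ if $[W]_{:,j}\ne0$, and otherwise the unit vector $e_i\in\mathbb{R}^n$, with $i$ the smallest index attaining $\min_{i\in\mathrm{supp}([S]_{:,j})}[\nabla f(Z)-\eta Z]_{i,j}$ (this is a global minimizer of $\bar f_Z$ over $\{X\in\mathcal{O}^{n,p}_+:\mathrm{supp}(X)\subseteq\mathrm{supp}(S)\}$).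 For $k=0,1,2,\dots$: 1. Let $S_k$ be given by: row $i$ of $S_k$ equals $\mathrm{sign}([X_k]_{i,:})$ if $i\notin\mathrm{zrow}(X_k)$; if $i\in\mathrm{zrow}(X_k)$, row $i$ of $S_k$ has a single $1$ in column $j_k^{(i)}$, the smallest index in $\arg\min_j[\nabla f(X_k)]_{i,j}$, and zeros elsewhere. Set $Y_k=\Pi(X_k,S_k)$. 2. If $\|Y_k-X_k\|_F\ge\theta$, set $X_{k+1}=Y_k$. 3. Otherwise, let $\delta_k=\max\{\delta,\min\{[Y_k]_{i,j}:(i,j)\in\mathrm{supp}(Y_k)\}\}$, enumerate $\{i:0<\|[Y_k]_{i,:}\|_2\le\delta_k\}=\{u^{(1)},\dots,u^{(r_k)}\}$, and set $\hat Y_k^{(0)}=Y_k$. For $t=1,\dots,r_k$: if row $u^{(t)}$ of $\hat Y_k^{(t-1)}$ contains an entry equal to $1$, set $\hat Y_k^{(t)}=\hat Y_k^{(t-1)}$; otherwise, for each $v\in\{1,\dots,p\}$ define $\hat S_k^{(t,v)}$ by: row $i$ equals $\mathrm{sign}([\hat Y_k^{(t-1)}]_{i,:})$ if $i\notin\mathrm{zrow}(Y_k)$ and $i\ne u^{(t)}$; row $i\in\mathrm{zrow}(Y_k)$ has a single $1$ in column $\hat j_k^{(i)}$, the smallest index in $\arg\min_j[\nabla f(Y_k)]_{i,j}$, and zeros elsewhere; row $u^{(t)}$ has a single $1$ in column $v$ and zeros elsewhere. Set $\hat Y_k^{(t,v)}=\Pi(Y_k,\hat S_k^{(t,v)})$,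 let $v^{(t)}$ be the smallest index in $\arg\min_{v}\bar f_{Y_k}(\hat Y_k^{(t,v)})$, and set $\hat Y_k^{(t)}=\hat Y_k^{(t,v^{(t)})}$. Finally set $X_{k+1}=\hat Y_k^{(r_k)}$.
   Formalization: The gradient of f is assumed Lipschitz with constant L on the convex hull of O^{n,p}, not only over O^{n,p}; with the Lipschitz condition on O^{n,p} alone the iterates can cycle and the claim fails. *)

theory Defs
  imports "HOL-Analysis.Analysis"
begin

type_synonym ('n, 'p) rmat = "real^'p^'n"

text \<open>
  An \<open>n \<times> p\<close> matrix is an element of \<open>('n, 'p) rmat\<close>, so that \<open>X $ i\<close> is row \<open>i\<close>, the
  library norm is the Frobenius norm and the library inner product is \<open>tr (A\<^sup>T B)\<close>. The index
  types carry a linear order because ties are broken by taking the smallest index.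
\<close>

definition stiefel :: "(('n::finite, 'p::finite) rmat) set" where
  "stiefel = {X. transpose X ** X = mat 1}"

text \<open>
  This set is not convex. The theorem asks for a Lipschitz gradient on its convex hull, since that
  is what the quadratic upper bound
  \<open>f X \<le> f Z + \<nabla>f(Z) \<bullet> (X - Z) + L/2 * (norm (X - Z))\<^sup>2\<close> for \<open>X\<close>, \<open>Z\<close> in the set requires;
  with the Lipschitz condition on the set alone that bound fails, and the iterates can cycle.
\<close>

definition nn_stiefel :: "(('n::finite, 'p::finite) rmat) set" where
  "nn_stiefel = {X \<in> stiefel. \<forall>i j. 0 \<le> X $ i $ j}"

definition mat_supp :: "('n::finite, 'p::finite) rmat \<Rightarrow> ('n \<times> 'p) set" where
  "mat_supp X = {(i, j). X $ i $ j \<noteq> 0}"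

definition zrow :: "('n::finite, 'p::finite) rmat \<Rightarrow> 'n set" where
  "zrow X = {i. X $ i = 0}"

text \<open>Entrywise sign; the library's \<^const>\<open>sgn\<close> on vectors is normalisation.\<close>

definition sign_row :: "real^'p \<Rightarrow> real^'p" where
  "sign_row x = (\<chi> j. sgn (x $ j))"

definition Diag :: "('p::finite, 'p) rmat \<Rightarrow> ('p, 'p) rmat" where
  "Diag B = (\<chi> i j. if i = j then B $ i $ j else 0)"

definition first_argmin :: "'a::linorder set \<Rightarrow> ('a \<Rightarrow> real) \<Rightarrow> 'a" where
  "first_argmin A h = Min {i \<in> A. \<forall>i' \<in> A. h i \<le> h i'}"

text \<open>Throughout, \<open>g\<close> stands for the Euclidean gradient of the objective \<open>f\<close>.\<close>

definition grad_proj :: "(('n::finite, 'p::finite) rmat \<Rightarrow> ('n, 'p) rmat) \<Rightarrow> ('n, 'p) rmat \<Rightarrow> ('n, 'p) rmat" where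
  "grad_proj g X = g X - X ** Diag (transpose X ** g X)"

definition approx_stationary :: "(('n::finite, 'p::finite) rmat \<Rightarrow> ('n, 'p) rmat) \<Rightarrow> real \<Rightarrow> ('n, 'p) rmat \<Rightarrow> bool" where
  "approx_stationary g \<epsilon> X \<longleftrightarrow>
     X \<in> nn_stiefel \<and>
     (\<forall>(i, j) \<in> mat_supp X. \<bar>grad_proj g X $ i $ j\<bar> \<le> \<epsilon>) \<and>
     (\<forall>i \<in> zrow X. \<forall>j. g X $ i $ j \<ge> - \<epsilon>)"

definition prox_model ::
  "(('n::finite, 'p::finite) rmat \<Rightarrow> real) \<Rightarrow> (('n, 'p) rmat \<Rightarrow> ('n, 'p) rmat) \<Rightarrow> real \<Rightarrow> ('n, 'p) rmat \<Rightarrow> ('n, 'p) rmat \<Rightarrow> real" where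
  "prox_model f g \<eta> Z X = f Z + g Z \<bullet> (X - Z) + \<eta> / 2 * (norm (X - Z))\<^sup>2"

text \<open>The map \<open>\<Pi>(Z, S)\<close>.\<close>

definition supp_proj ::
  "(('n::{finite,linorder}, 'p::finite) rmat \<Rightarrow> ('n, 'p) rmat) \<Rightarrow> real \<Rightarrow> ('n, 'p) rmat \<Rightarrow> ('n, 'p) rmat \<Rightarrow> ('n, 'p) rmat" where
  "supp_proj g \<eta> Z S =
     (let W = (\<chi> i j. max 0 ((\<eta> *\<^sub>R Z - g Z) $ i $ j * S $ i $ j))
      in \<chi> i j. if column j W \<noteq> 0 then W $ i $ j / norm (column j W)
          else if i = first_argmin {i. S $ i $ j \<noteq> 0} (\<lambda>i. (g Z - \<eta> *\<^sub>R Z) $ i $ j) then 1 else 0)"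

definition row_argmin :: "(('n::finite, 'p::{finite,linorder}) rmat \<Rightarrow> ('n, 'p) rmat) \<Rightarrow> ('n, 'p) rmat \<Rightarrow> 'n \<Rightarrow> 'p" where
  "row_argmin g X i = first_argmin UNIV (\<lambda>j. g X $ i $ j)"

text \<open>The support matrix \<open>S\<^sub>k\<close> built from \<open>X = X\<^sub>k\<close>.\<close>

definition supp_fill :: "(('n::finite, 'p::{finite,linorder}) rmat \<Rightarrow> ('n, 'p) rmat) \<Rightarrow> ('n, 'p) rmat \<Rightarrow> ('n, 'p) rmat" where
  "supp_fill g X = (\<chi> i. if i \<in> zrow X then axis (row_argmin g X i) 1 else sign_row (X $ i))"

text \<open>
  The trial support in step 3, with \<open>Y = Y\<^sub>k\<close>, \<open>V\<close> the current inner iterate, \<open>u\<close> the row being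
  processed and \<open>v\<close> the trial column.
\<close>

definition supp_trial ::
  "(('n::finite, 'p::{finite,linorder}) rmat \<Rightarrow> ('n, 'p) rmat) \<Rightarrow> ('n, 'p) rmat \<Rightarrow> ('n, 'p) rmat \<Rightarrow> 'n \<Rightarrow> 'p \<Rightarrow> ('n, 'p) rmat" where
  "supp_trial g Y V u v =
     (\<chi> i. if i = u then axis v 1
          else if i \<in> zrow Y then axis (row_argmin g Y i) 1
          else sign_row (V $ i))"

definition row_step ::
  "(('n::{finite,linorder}, 'p::{finite,linorder}) rmat \<Rightarrow> real) \<Rightarrow> (('n, 'p) rmat \<Rightarrow> ('n, 'p) rmat) \<Rightarrow> real
     \<Rightarrow> ('n, 'p) rmat \<Rightarrow> 'n \<Rightarrow> ('n, 'p) rmat \<Rightarrow> ('n, 'p) rmat" where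
  "row_step f g \<eta> Y u V =
     (if \<exists>j. V $ u $ j = 1 then V
      else let trial = (\<lambda>v. supp_proj g \<eta> Y (supp_trial g Y V u v))
           in trial (first_argmin UNIV (\<lambda>v. prox_model f g \<eta> Y (trial v))))"

definition row_threshold :: "real \<Rightarrow> ('n::finite, 'p::finite) rmat \<Rightarrow> real" where
  "row_threshold \<delta> Y = max \<delta> (Min ((\<lambda>(i, j). Y $ i $ j) ` mat_supp Y))"

definition small_rows :: "real \<Rightarrow> ('n::finite, 'p::finite) rmat \<Rightarrow> 'n set" where
  "small_rows \<delta> Y = {i. 0 < norm (Y $ i) \<and> norm (Y $ i) \<le> row_threshold \<delta> Y}"

text \<open>
  \<open>X\<close> and \<open>Y\<close> are sequences generated by the algorithm. The order in which the small rows are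
  enumerated is left open, hence a predicate rather than a recursive function: every iteration
  may use any enumeration \<open>us\<close>.
\<close>

definition support_set_iterates ::
  "(('n::{finite,linorder}, 'p::{finite,linorder}) rmat \<Rightarrow> real) \<Rightarrow> (('n, 'p) rmat \<Rightarrow> ('n, 'p) rmat)
     \<Rightarrow> real \<Rightarrow> real \<Rightarrow> real \<Rightarrow> ('n, 'p) rmat \<Rightarrow> (nat \<Rightarrow> ('n, 'p) rmat) \<Rightarrow> (nat \<Rightarrow> ('n, 'p) rmat) \<Rightarrow> bool" where
  "support_set_iterates f g \<eta> \<delta> \<theta> X0 X Y \<longleftrightarrow>
     X 0 = X0 \<and>
     (\<forall>k. Y k = supp_proj g \<eta> (X k) (supp_fill g (X k)) \<and>
          (if norm (Y k - X k) \<ge> \<theta> then X (Suc k) = Y k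
           else \<exists>us. distinct us \<and> set us = small_rows \<delta> (Y k) \<and>
                     X (Suc k) = fold (row_step f g \<eta> (Y k)) us (Y k)))"

end

theory Submission
  imports Defs
begin

text \<open>
  A nonnegative matrix with orthonormal columns has at most one nonzero entry per row, so a
  prescribed support splits the feasible set into independent unit spheres, one per column. On that
  set \<open>norm X\<close> is constant, hence the proximal model is linear in \<open>X\<close> up to a constant, and
  \<open>\<Pi>(Z, S)\<close> minimises it exactly (\<open>supp_proj_minimises\<close>). Every candidate \<open>V\<close> the algorithm accepts
  competes, directly or through earlier candidates, against the base point \<open>Z\<close> itself, so its model
  value is at most \<open>f Z\<close>; as \<open>\<eta>\<close> exceeds the
  Lipschitz constant, \<open>f V \<le> f Z - (\<eta> - L)/2 * (norm (V - Z))\<^sup>2\<close> (\<open>sufficient_decrease\<close>). Since \<open>f\<close> is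
  bounded below on the feasible set, the squared step lengths are summable, and among the first
  \<open>O(\<rho>\<^sup>-\<^sup>2)\<close> iterations there is one where \<open>X\<^sub>k\<close>, \<open>Y\<^sub>k\<close>, \<open>X\<^sub>k\<^sub>+\<^sub>1\<close> and \<open>Y\<^sub>k\<^sub>+\<^sub>1\<close> are successively
  less than \<open>\<rho>\<close> apart (\<open>consecutive_small_steps\<close>).

  It remains to see that such short steps force approximate stationarity when \<open>\<rho>\<close> is a small constant
  times \<open>\<epsilon>\<close> (\<open>small_steps_stationary\<close>). On the support of \<open>Y\<^sub>k\<close> the optimality conditions of the
  projection bound the projected gradient by a multiple of the step. For a zero row of \<open>Y\<^sub>k\<close> that was
  already zero in \<open>X\<^sub>k\<close>, the projection could have put mass on the entry of smallest gradient and
  declined, so the gradient there is nonnegative at \<open>X\<^sub>k\<close>. The delicate rows are those nonzero in \<open>X\<^sub>k\<close>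
  and zero in \<open>Y\<^sub>k\<close>, and they are what the inner loop is for (\<open>inner_loop_dichotomy\<close>):
  \<^item> If the inner loop projects at least once, every zero row of \<open>Y\<^sub>k\<close> is offered its entry of smallest
    gradient; a very negative gradient there would make \<open>X\<^sub>k\<^sub>+\<^sub>1\<close> move far from \<open>Y\<^sub>k\<close>.
  \<^item> Otherwise \<open>X\<^sub>k\<^sub>+\<^sub>1 = Y\<^sub>k\<close> and all its nonzero entries are at least \<open>\<delta>\<close>. Then a short step from
    \<open>X\<^sub>k\<^sub>+\<^sub>1\<close> to \<open>Y\<^sub>k\<^sub>+\<^sub>1\<close> cannot create a new zero row, and \<open>Y\<^sub>k\<^sub>+\<^sub>1\<close> is approximately stationary.
\<close>

section \<open>Nonnegative matrices with orthonormal columns\<close>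

lemma norm_rmat_sq:
  fixes A :: "('n::finite, 'p::finite) rmat"
  shows "(norm A)\<^sup>2 = (\<Sum>j\<in>UNIV. \<Sum>i\<in>UNIV. (A $ i $ j)\<^sup>2)"
  unfolding power2_norm_eq_inner inner_vec_def
  by (subst sum.swap) (simp add: power2_eq_square)

lemma inner_rmat_columns:
  fixes A B :: "('n::finite, 'p::finite) rmat"
  shows "A \<bullet> B = (\<Sum>j\<in>UNIV. \<Sum>i\<in>UNIV. A $ i $ j * B $ i $ j)"
  unfolding inner_vec_def by (subst sum.swap) simp

lemma norm_column_sq:
  fixes A :: "('n::finite, 'p::finite) rmat"
  shows "(norm (column j A))\<^sup>2 = (\<Sum>i\<in>UNIV. (A $ i $ j)\<^sup>2)"
  unfolding power2_norm_eq_inner inner_vec_def column_def by (simp add: power2_eq_square)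

lemma norm_column_le:
  fixes A :: "('n::finite, 'p::finite) rmat"
  shows "norm (column j A) \<le> norm A"
proof (rule power2_le_imp_le)
  show "(norm (column j A))\<^sup>2 \<le> (norm A)\<^sup>2"
    unfolding norm_rmat_sq norm_column_sq
    by (rule member_le_sum[where f = "\<lambda>j. \<Sum>i\<in>UNIV. (A $ i $ j)\<^sup>2"]) (auto intro: sum_nonneg)
qed simp

lemma abs_entry_le_norm:
  fixes A :: "('n::finite, 'p::finite) rmat"
  shows "\<bar>A $ i $ j\<bar> \<le> norm A"
  using component_le_norm_cart[of "A $ i" j] Finite_Cartesian_Product.norm_nth_le[of A i] by linarith

lemma norm_axis_real: "norm (axis j (a::real)) = \<bar>a\<bar>"
  by (simp add: norm_eq_sqrt_inner inner_axis_axis)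

text \<open>
  Off-diagonal entries of the Gram matrix are sums of nonnegative terms, so they vanish only if
  every term does: orthogonality of the columns becomes disjointness of their supports.
\<close>

lemma nn_stiefel_iff:
  fixes X :: "('n::finite, 'p::finite) rmat"
  shows "X \<in> nn_stiefel \<longleftrightarrow>
    (\<forall>i j. 0 \<le> X $ i $ j) \<and> (\<forall>j. (\<Sum>i\<in>UNIV. (X $ i $ j)\<^sup>2) = 1) \<and>
    (\<forall>i j k. X $ i $ j \<noteq> 0 \<longrightarrow> X $ i $ k \<noteq> 0 \<longrightarrow> j = k)"
proof -
  have gram: "X \<in> stiefel \<longleftrightarrow> (\<forall>j k. (\<Sum>i\<in>UNIV. X $ i $ j * X $ i $ k) = (if j = k then 1 else 0))"
    by (simp add: stiefel_def vec_eq_iff matrix_matrix_mult_def transpose_def mat_def)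
  show ?thesis
  proof (cases "\<forall>i j. 0 \<le> X $ i $ j")
    case True
    have "(\<Sum>i\<in>UNIV. X $ i $ j * X $ i $ k) = 0 \<longleftrightarrow> (\<forall>i. X $ i $ j = 0 \<or> X $ i $ k = 0)" for j k
      by (subst sum_nonneg_eq_0_iff) (use True in auto)
    moreover have "(\<Sum>i\<in>UNIV. X $ i $ j * X $ i $ j) = (\<Sum>i\<in>UNIV. (X $ i $ j)\<^sup>2)" for j
      by (simp add: power2_eq_square)
    moreover have "X \<in> stiefel \<longleftrightarrow> (\<forall>j. (\<Sum>i\<in>UNIV. X $ i $ j * X $ i $ j) = 1) \<and>
        (\<forall>j k. j \<noteq> k \<longrightarrow> (\<Sum>i\<in>UNIV. X $ i $ j * X $ i $ k) = 0)"
      unfolding gram by auto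
    ultimately have "X \<in> stiefel \<longleftrightarrow> (\<forall>j. (\<Sum>i\<in>UNIV. (X $ i $ j)\<^sup>2) = 1) \<and>
        (\<forall>i j k. X $ i $ j \<noteq> 0 \<longrightarrow> X $ i $ k \<noteq> 0 \<longrightarrow> j = k)"
      by (simp only:) blast
    then show ?thesis using True by (auto simp: nn_stiefel_def)
  qed (auto simp: nn_stiefel_def)
qed

lemma nn_stiefelD:
  assumes "X \<in> nn_stiefel"
  shows "0 \<le> X $ i $ j" "(\<Sum>i\<in>UNIV. (X $ i $ j)\<^sup>2) = 1"
    "X $ i $ j \<noteq> 0 \<Longrightarrow> X $ i $ k \<noteq> 0 \<Longrightarrow> j = k"
  using assms unfolding nn_stiefel_iff by blast+

lemma nn_stiefel_le_1:
  assumes "X \<in> nn_stiefel"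
  shows "X $ i $ j \<le> 1"
proof -
  have "(X $ i $ j)\<^sup>2 \<le> (\<Sum>i\<in>UNIV. (X $ i $ j)\<^sup>2)"
    by (rule member_le_sum) auto
  then show ?thesis using nn_stiefelD(2)[OF assms]
    by (metis abs_square_le_1 abs_le_D1)
qed

lemma nn_stiefel_norm_sq:
  fixes X :: "('n::finite, 'p::finite) rmat"
  assumes "X \<in> nn_stiefel"
  shows "(norm X)\<^sup>2 = CARD('p)"
  unfolding norm_rmat_sq using nn_stiefelD(2)[OF assms] by simp

lemma nn_stiefel_column_nonzero:
  assumes "X \<in> nn_stiefel"
  obtains i where "X $ i $ j \<noteq> 0"
proof -
  have "\<exists>i. X $ i $ j \<noteq> 0"
    using nn_stiefelD(2)[OF assms, of j] by (rule contrapos_pp) simp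
  then show thesis using that by blast
qed

section \<open>Projection onto a prescribed support\<close>

lemma
  fixes A :: "'a::linorder set"
  assumes "finite A" "A \<noteq> {}"
  shows first_argmin_in: "first_argmin A h \<in> A"
    and first_argmin_le: "x \<in> A \<Longrightarrow> h (first_argmin A h) \<le> h x"
proof -
  let ?B = "{i \<in> A. \<forall>i'\<in>A. h i \<le> h i'}"
  obtain a where "is_arg_min h (\<lambda>x. x \<in> A) a" 
    using ex_is_arg_min_if_finite[OF assms] by blast
  then have "a \<in> ?B" by (auto simp: is_arg_min_linorder)
  then have "Min ?B \<in> ?B" by (intro Min_in) (use assms in auto)
  then show "first_argmin A h \<in> A" "x \<in> A \<Longrightarrow> h (first_argmin A h) \<le> h x"
    by (auto simp: first_argmin_def)
qed

text \<open>The sign matrices of elements of \<^const>\<open>nn_stiefel\<close>.\<close>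

definition sign_pattern :: "('n::finite, 'p::finite) rmat \<Rightarrow> bool" where
  "sign_pattern S \<longleftrightarrow> (\<forall>i j. S $ i $ j = 0 \<or> S $ i $ j = 1) \<and>
     (\<forall>i j k. S $ i $ j \<noteq> 0 \<longrightarrow> S $ i $ k \<noteq> 0 \<longrightarrow> j = k) \<and> (\<forall>j. \<exists>i. S $ i $ j \<noteq> 0)"

text \<open>
  The case \<open>unit\<close> is the fallback for a column whose gradient step has no positive entry on the
  support. The normalising factor \<open>c\<close> is at most the length of the gradient step; this is what later
  turns a small entry of the projection into a small gradient entry.
\<close>

lemma supp_proj_column_cases:
  fixes Z S :: "('n::{finite,linorder}, 'p::finite) rmat"
    and g :: "('n, 'p) rmat \<Rightarrow> ('n, 'p) rmat" and \<eta> :: real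
  assumes "sign_pattern S"
  defines "w \<equiv> \<lambda>i j. max 0 ((\<eta> * Z $ i $ j - g Z $ i $ j) * S $ i $ j)"
  obtains
    (normalised) c where "0 < c" "c \<le> norm (\<eta> *\<^sub>R Z - g Z)" "c\<^sup>2 = (\<Sum>i\<in>UNIV. (w i j)\<^sup>2)"
      "\<And>i. supp_proj g \<eta> Z S $ i $ j = w i j / c"
  | (unit) i0 where "\<And>i. w i j = 0" "S $ i0 $ j = 1"
      "\<And>i. S $ i $ j \<noteq> 0 \<Longrightarrow> g Z $ i0 $ j - \<eta> * Z $ i0 $ j \<le> g Z $ i $ j - \<eta> * Z $ i $ j"
      "\<And>i. supp_proj g \<eta> Z S $ i $ j = (if i = i0 then 1 else 0)"
proof -
  define W :: "('n, 'p) rmat" where "W = (\<chi> i j. w i j)"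
  let ?A = "{i. S $ i $ j \<noteq> 0}" and ?h = "\<lambda>i. g Z $ i $ j - \<eta> * Z $ i $ j"
  have Y: "supp_proj g \<eta> Z S $ i $ j = (if column j W \<noteq> 0 then w i j / norm (column j W)
      else if i = first_argmin ?A ?h then 1 else 0)" for i
    unfolding supp_proj_def Let_def W_def w_def by simp
  show thesis
  proof (cases "column j W = 0")
    case False
    have "\<bar>w i j\<bar> \<le> \<bar>(\<eta> *\<^sub>R Z - g Z) $ i $ j\<bar>" for i
    proof -
      have "S $ i $ j = 0 \<or> S $ i $ j = 1" using assms(1) unfolding sign_pattern_def by blast
      then show ?thesis by (auto simp: w_def)
    qed
    then have "(norm (column j W))\<^sup>2 \<le> (norm (column j (\<eta> *\<^sub>R Z - g Z)))\<^sup>2"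
      unfolding norm_column_sq W_def by (intro sum_mono) (simp add: abs_le_square_iff)
    then have "norm (column j W) \<le> norm (\<eta> *\<^sub>R Z - g Z)"
      using norm_column_le[of j "\<eta> *\<^sub>R Z - g Z"] by (meson norm_ge_zero order_trans power2_le_imp_le)
    moreover have "(norm (column j W))\<^sup>2 = (\<Sum>i\<in>UNIV. (w i j)\<^sup>2)"
      unfolding norm_column_sq W_def by simp
    ultimately show thesis
      using normalised[of "norm (column j W)"] False Y by simp
  next
    case True
    have "?A \<noteq> {}" using assms(1) unfolding sign_pattern_def by blast
    then have am: "first_argmin ?A ?h \<in> ?A" "\<And>i. i \<in> ?A \<Longrightarrow> ?h (first_argmin ?A ?h) \<le> ?h i"
      using first_argmin_in[where A = ?A and h = ?h] first_argmin_le[where A = ?A and h = ?h] by auto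
    have "w i j = 0" for i using True by (simp add: column_def W_def vec_eq_iff)
    show thesis
    proof (rule unit)
      show "w i j = 0" for i by fact
      show "S $ first_argmin ?A ?h $ j = 1"
        using am(1) assms(1) unfolding sign_pattern_def by blast
      show "?h (first_argmin ?A ?h) \<le> ?h i" if "S $ i $ j \<noteq> 0" for i
        using am(2) that by blast
      show "supp_proj g \<eta> Z S $ i $ j = (if i = first_argmin ?A ?h then 1 else 0)" for i
        using Y True by simp
    qed
  qed
qed

lemma supp_proj_supp:
  assumes "sign_pattern S" "supp_proj g \<eta> Z S $ i $ j \<noteq> 0"
  shows "S $ i $ j = 1"
proof -
  have "S $ i $ j \<noteq> 0"
  using assms(1)
  proof (cases rule: supp_proj_column_cases[where \<eta> = \<eta> and Z = Z and g = g and j = j])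
    case (normalised c)
    then show ?thesis using assms(2) by auto
  next
    case (unit i0)
    then have "i = i0" using assms(2) by (simp split: if_splits)
    then show ?thesis using unit(2) by simp
  qed
  then show ?thesis using assms(1) unfolding sign_pattern_def by blast
qed

lemma supp_proj_in_nn_stiefel:
  assumes S: "sign_pattern S"
  shows "supp_proj g \<eta> Z S \<in> nn_stiefel"
  unfolding nn_stiefel_iff
proof (intro conjI allI impI)
  fix i j k
  show "0 \<le> supp_proj g \<eta> Z S $ i $ j"
    using S
    by (cases rule: supp_proj_column_cases[where \<eta> = \<eta> and Z = Z and g = g and j = j]) auto
  show "(\<Sum>i\<in>UNIV. (supp_proj g \<eta> Z S $ i $ j)\<^sup>2) = 1"
  using S
  proof (cases rule: supp_proj_column_cases[where \<eta> = \<eta> and Z = Z and g = g and j = j])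
    case (normalised c)
    have "c\<^sup>2 \<noteq> 0" using normalised(1) by simp
    then show ?thesis
      unfolding normalised(4) power_divide sum_divide_distrib[symmetric] normalised(3)[symmetric] by simp
  next
    case (unit i0)
    then show ?thesis by (simp add: if_distrib[where f = "\<lambda>x. x\<^sup>2"] cong: if_cong)
  qed
  assume "supp_proj g \<eta> Z S $ i $ j \<noteq> 0" "supp_proj g \<eta> Z S $ i $ k \<noteq> 0"
  then show "j = k" using supp_proj_supp[OF S] S unfolding sign_pattern_def
    by (metis zero_neq_one)
qed

text \<open>
  On \<^const>\<open>nn_stiefel\<close> the quadratic term of the model in \<open>X\<close> is constant because \<open>norm X\<close> is.
\<close>

lemma prox_model_linear:
  fixes X :: "('n::finite, 'p::finite) rmat"
  assumes "X \<in> nn_stiefel"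
  shows "prox_model f g \<eta> Z X = (g Z - \<eta> *\<^sub>R Z) \<bullet> X
     + (f Z - g Z \<bullet> Z + \<eta> / 2 * (CARD('p) + (norm Z)\<^sup>2))"
proof -
  have "(norm (X - Z))\<^sup>2 = CARD('p) + (norm Z)\<^sup>2 - 2 * (Z \<bullet> X)"
    using nn_stiefel_norm_sq[OF assms]
    by (simp add: power2_norm_eq_inner inner_diff_left inner_diff_right inner_commute)
  then have "\<eta> / 2 * (norm (X - Z))\<^sup>2 = \<eta> / 2 * (CARD('p) + (norm Z)\<^sup>2) - \<eta> * (Z \<bullet> X)"
    by (simp add: right_diff_distrib)
  then show ?thesis unfolding prox_model_def
    by (simp add: inner_diff_left inner_diff_right)
qed

text \<open>
  Columns can be treated separately. If \<open>w\<close> is the positive part of the gradient step on the support,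
  the linear form is at least \<open>- w \<bullet> x \<ge> - norm w\<close> for a nonnegative unit vector \<open>x\<close>, with equality
  at \<open>w / norm w\<close>. If \<open>w = 0\<close>, all coefficients on the support are nonnegative, and since
  \<open>x\<^sub>i \<ge> x\<^sub>i\<^sup>2\<close> the form is at least the smallest coefficient, attained at a unit vector.
\<close>

lemma supp_proj_minimises:
  assumes S: "sign_pattern S" and X: "X \<in> nn_stiefel"
    and supp: "\<And>i j. X $ i $ j \<noteq> 0 \<Longrightarrow> S $ i $ j \<noteq> 0"
  shows "prox_model f g \<eta> Z (supp_proj g \<eta> Z S) \<le> prox_model f g \<eta> Z X"
proof -
  let ?Y = "supp_proj g \<eta> Z S" and ?G = "g Z - \<eta> *\<^sub>R Z"
  have S01: "S $ i $ j \<noteq> 0 \<Longrightarrow> S $ i $ j = 1" for i j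
    using S unfolding sign_pattern_def by blast
  have "(\<Sum>i\<in>UNIV. ?G $ i $ j * ?Y $ i $ j) \<le> (\<Sum>i\<in>UNIV. ?G $ i $ j * X $ i $ j)" for j
  using S
  proof (cases rule: supp_proj_column_cases[where \<eta> = \<eta> and Z = Z and g = g and j = j])
    case (normalised c)
    define w where "w = (\<lambda>i. max 0 ((\<eta> * Z $ i $ j - g Z $ i $ j) * S $ i $ j))"
    have Y: "?Y $ i $ j = w i / c" for i using normalised by (simp add: w_def)
    have c2: "c\<^sup>2 = (\<Sum>i\<in>UNIV. (w i)\<^sup>2)" using normalised by (simp add: w_def)
    have "?G $ i $ j * w i = - (w i)\<^sup>2" for i
      using S01[of i j] by (cases "S $ i $ j = 0") (auto simp: w_def max_def power2_eq_square algebra_simps)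
    then have "?G $ i $ j * ?Y $ i $ j = - (w i)\<^sup>2 / c" for i
      unfolding Y by (metis times_divide_eq_right)
    then have "(\<Sum>i\<in>UNIV. ?G $ i $ j * ?Y $ i $ j) = - (c\<^sup>2) / c"
      unfolding c2 by (simp add: sum_negf flip: sum_divide_distrib)
    then have YG: "(\<Sum>i\<in>UNIV. ?G $ i $ j * ?Y $ i $ j) = - c" 
      using normalised(1) by (simp add: power2_eq_square)
    have "(\<Sum>i\<in>UNIV. w i * X $ i $ j) \<le> L2_set w UNIV * L2_set (\<lambda>i. X $ i $ j) UNIV"
      by (rule order_trans[OF sum_mono L2_set_mult_ineq]) (simp flip: abs_mult)
    also have "\<dots> = c" unfolding L2_set_def c2[symmetric] nn_stiefelD(2)[OF X] using normalised(1) by simp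
    finally have "- c \<le> (\<Sum>i\<in>UNIV. - w i * X $ i $ j)" by (simp add: sum_negf)
    also have "\<dots> \<le> (\<Sum>i\<in>UNIV. ?G $ i $ j * X $ i $ j)"
    proof (rule sum_mono)
      fix i
      show "- w i * X $ i $ j \<le> ?G $ i $ j * X $ i $ j"
      proof (cases "X $ i $ j = 0")
        case False
        then have "- w i \<le> ?G $ i $ j" using supp[OF False] S01[of i j] by (simp add: w_def)
        then show ?thesis using nn_stiefelD(1)[OF X] by (rule mult_right_mono)
      qed simp
    qed
    finally show ?thesis using YG by simp
  next
    case (unit i0)
    have pos: "0 \<le> ?G $ i0 $ j" using unit(1)[of i0] unit(2) by (simp add: max_def split: if_splits)
    have "(\<Sum>i\<in>UNIV. ?G $ i $ j * ?Y $ i $ j) = ?G $ i0 $ j * (\<Sum>i\<in>UNIV. (X $ i $ j)\<^sup>2)"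
      unfolding unit(4) nn_stiefelD(2)[OF X] by (simp add: if_distrib[where f = "\<lambda>x. _ * x"] cong: if_cong)
    also have "\<dots> \<le> (\<Sum>i\<in>UNIV. ?G $ i $ j * X $ i $ j)"
      unfolding sum_distrib_left
    proof (rule sum_mono)
      fix i
      show "?G $ i0 $ j * (X $ i $ j)\<^sup>2 \<le> ?G $ i $ j * X $ i $ j"
      proof (cases "X $ i $ j = 0")
        case False
        have "?G $ i0 $ j \<le> ?G $ i $ j" using unit(3)[OF supp[OF False]] by simp
        moreover have "(X $ i $ j)\<^sup>2 \<le> X $ i $ j"
          using nn_stiefelD(1)[OF X, of i j] nn_stiefel_le_1[OF X, of i j]
          by (simp add: power2_eq_square mult_left_le)
        ultimately show ?thesis
          using pos nn_stiefelD(1)[OF X, of i j] by (intro mult_mono) auto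
      qed simp
    qed
    finally show ?thesis .
  qed
  then have "?G \<bullet> ?Y \<le> ?G \<bullet> X" unfolding inner_rmat_columns by (rule sum_mono)
  then show ?thesis using prox_model_linear[OF X] prox_model_linear[OF supp_proj_in_nn_stiefel[OF S]]
    by simp
qed

section \<open>The support rule for the outer step\<close>

lemma sign_row_nonneg:
  "0 \<le> x $ j \<Longrightarrow> sign_row x $ j = (if x $ j = 0 then 0 else 1)"
  by (simp add: sign_row_def)

lemma supp_fill_pattern:
  assumes X: "X \<in> nn_stiefel"
  shows "sign_pattern (supp_fill g X)"
    and "X $ i $ j \<noteq> 0 \<Longrightarrow> supp_fill g X $ i $ j \<noteq> 0"
proof -
  have row: "supp_fill g X $ i $ j = (if i \<in> zrow X then if j = row_argmin g X i then 1 else 0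
      else if X $ i $ j = 0 then 0 else 1)" for i j
    by (simp add: supp_fill_def sign_row_nonneg nn_stiefelD(1)[OF X] axis_def)
  have nz: "X $ i $ j \<noteq> 0 \<Longrightarrow> supp_fill g X $ i $ j \<noteq> 0" for i j
    by (auto simp: row zrow_def)
  then show "X $ i $ j \<noteq> 0 \<Longrightarrow> supp_fill g X $ i $ j \<noteq> 0" .
  show "sign_pattern (supp_fill g X)"
    unfolding sign_pattern_def
  proof (intro conjI allI)
    show "\<exists>i. supp_fill g X $ i $ j \<noteq> 0" for j
      using nn_stiefel_column_nonzero[OF X, of j] nz by metis
  qed (use nn_stiefelD(3)[OF X] in \<open>auto simp: row split: if_splits\<close>)
qed

section \<open>Descent along a Lipschitz gradient\<close>

text \<open>
  The function \<open>\<psi>\<close> in the proof measures the gap along the segment from \<open>X\<close> to \<open>Y\<close>; convexity of \<open>C\<close>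
  keeps the segment where the gradient is Lipschitz, which makes \<open>\<psi>\<close> nonincreasing.
\<close>

lemma quadratic_upper_bound:
  fixes f :: "'a::euclidean_space \<Rightarrow> real"
  assumes grad: "\<And>Z. GDERIV f Z :> g Z" and lip: "L-lipschitz_on C g" and "convex C" "X \<in> C" "Y \<in> C"
  shows "f Y \<le> f X + g X \<bullet> (Y - X) + L / 2 * (norm (Y - X))\<^sup>2"
proof -
  define d where "d = Y - X"
  define \<psi> where "\<psi> t = f (X + t *\<^sub>R d) - t * (g X \<bullet> d) - L / 2 * t\<^sup>2 * (norm d)\<^sup>2" for t
  have "\<exists>y. (\<psi> has_real_derivative y) (at t) \<and> y \<le> 0" if t: "0 \<le> t" "t \<le> 1" for t
  proof (intro exI conjI)
    have "(f has_derivative (\<lambda>h. g (X + t *\<^sub>R d) \<bullet> h)) (at (X + t *\<^sub>R d))"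
      using grad[of "X + t *\<^sub>R d"] unfolding gderiv_def by (simp add: inner_commute)
    moreover have "((\<lambda>t. X + t *\<^sub>R d) has_derivative (\<lambda>s. s *\<^sub>R d)) (at t)"
      by (auto intro!: derivative_eq_intros)
    ultimately have "((\<lambda>t. f (X + t *\<^sub>R d)) has_derivative (\<lambda>s. g (X + t *\<^sub>R d) \<bullet> (s *\<^sub>R d))) (at t)"
      by (rule has_derivative_compose[rotated])
    then have "((\<lambda>t. f (X + t *\<^sub>R d)) has_real_derivative g (X + t *\<^sub>R d) \<bullet> d) (at t)"
      by (rule has_derivative_imp_has_field_derivative) simp
    then show "(\<psi> has_real_derivative g (X + t *\<^sub>R d) \<bullet> d - g X \<bullet> d - L * t * (norm d)\<^sup>2) (at t)"
      unfolding \<psi>_def by (auto intro!: derivative_eq_intros simp: power2_eq_square)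
    have "X + t *\<^sub>R d = (1 - t) *\<^sub>R X + t *\<^sub>R Y" by (simp add: d_def algebra_simps)
    then have "X + t *\<^sub>R d \<in> C" using assms t by (simp add: convexD)
    then have "norm (g (X + t *\<^sub>R d) - g X) \<le> L * (t * norm d)"
      using lipschitz_onD[OF lip, of "X + t *\<^sub>R d" X] assms t by (simp add: dist_norm)
    then have "(g (X + t *\<^sub>R d) - g X) \<bullet> d \<le> L * (t * norm d) * norm d"
      using norm_cauchy_schwarz[of "g (X + t *\<^sub>R d) - g X" d] mult_right_mono[OF _ norm_ge_zero[of d]]
      by (blast intro: order_trans)
    then show "g (X + t *\<^sub>R d) \<bullet> d - g X \<bullet> d - L * t * (norm d)\<^sup>2 \<le> 0"
      by (simp add: inner_diff_left power2_eq_square mult.assoc)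
  qed
  then have "\<psi> 1 \<le> \<psi> 0" by (rule DERIV_nonpos_imp_nonincreasing[OF zero_le_one])
  then show ?thesis by (simp add: \<psi>_def d_def)
qed

section \<open>The inner loop\<close>

text \<open>
  Invariant of the inner loop. It is what makes the current inner iterate a competitor in the next
  projection: on the rows that are zero in \<open>Y\<close> the trial support is the one column of smallest gradient.
\<close>

definition fills_zero_rows ::
  "(('n::finite, 'p::{finite,linorder}) rmat \<Rightarrow> ('n, 'p) rmat) \<Rightarrow> ('n, 'p) rmat \<Rightarrow> ('n, 'p) rmat \<Rightarrow> bool" where
  "fills_zero_rows g Y V \<longleftrightarrow>
     V \<in> nn_stiefel \<and> (\<forall>i\<in>zrow Y. \<forall>j. V $ i $ j \<noteq> 0 \<longrightarrow> j = row_argmin g Y i)"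

lemma supp_trial_entry:
  assumes "V \<in> nn_stiefel"
  shows "supp_trial g Y V u v $ i $ j = (if i = u then if j = v then 1 else 0
    else if i \<in> zrow Y then if j = row_argmin g Y i then 1 else 0
    else if V $ i $ j = 0 then 0 else 1)"
  by (simp add: supp_trial_def sign_row_nonneg nn_stiefelD(1)[OF assms] axis_def)

text \<open>
  Redirecting row \<open>u\<close> cannot empty a column: a column supported on row \<open>u\<close> alone would have the
  entry 1 there, and the inner loop skips such rows.
\<close>

lemma supp_trial_pattern:
  assumes "fills_zero_rows g Y V" and no1: "\<nexists>j. V $ u $ j = 1"
  shows "sign_pattern (supp_trial g Y V u v)"
proof -
  have V: "V \<in> nn_stiefel" and fill: "\<And>i j. i \<in> zrow Y \<Longrightarrow> V $ i $ j \<noteq> 0 \<Longrightarrow> j = row_argmin g Y i"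
    using assms(1) by (auto simp: fills_zero_rows_def)
  note row = supp_trial_entry[OF V, of g Y u v]
  have ex: "\<exists>i. i \<noteq> u \<and> V $ i $ j \<noteq> 0" for j
  proof (rule ccontr)
    assume *: "\<not> ?thesis"
    have "(\<Sum>i\<in>UNIV. (V $ i $ j)\<^sup>2) = (\<Sum>i\<in>{u}. (V $ i $ j)\<^sup>2)"
      by (rule sum.mono_neutral_right) (use * in auto)
    then have "(V $ u $ j)\<^sup>2 = 1" using nn_stiefelD(2)[OF V] by simp
    then have "V $ u $ j = 1" using nn_stiefelD(1)[OF V, of u j] by (auto simp: power2_eq_1_iff)
    then show False using no1 by blast
  qed
  show ?thesis
    unfolding sign_pattern_def
  proof (intro conjI allI)
    show "\<exists>i. supp_trial g Y V u v $ i $ j \<noteq> 0" for j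
    proof -
      obtain i where "i \<noteq> u" "V $ i $ j \<noteq> 0" using ex by blast
      then have "supp_trial g Y V u v $ i $ j \<noteq> 0" using fill[of i j] by (simp add: row)
      then show ?thesis ..
    qed
  qed (use nn_stiefelD(3)[OF V] in \<open>auto simp: row split: if_splits\<close>)
qed

text \<open>
  The model value does not increase, because the trial column that row \<open>u\<close> occupies at present (any
  column, if the row is zero) gives a support containing that of \<open>V\<close>.
\<close>

lemma row_step_cases:
  fixes Y V :: "('n::{finite,linorder}, 'p::{finite,linorder}) rmat"
  assumes fill: "fills_zero_rows g Y V"
  obtains (keep) j where "V $ u $ j = 1" "row_step f g \<eta> Y u V = V"
  | (trial) v where "sign_pattern (supp_trial g Y V u v)"
      "row_step f g \<eta> Y u V = supp_proj g \<eta> Y (supp_trial g Y V u v)"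
      "prox_model f g \<eta> Y (row_step f g \<eta> Y u V) \<le> prox_model f g \<eta> Y V"
proof (cases "\<exists>j. V $ u $ j = 1")
  case True
  then show thesis using keep by (auto simp: row_step_def)
next
  case False
  have V: "V \<in> nn_stiefel" using fill by (simp add: fills_zero_rows_def)
  let ?trial = "\<lambda>v. supp_proj g \<eta> Y (supp_trial g Y V u v)"
  define v where "v = first_argmin UNIV (\<lambda>v. prox_model f g \<eta> Y (?trial v))"
  have step: "row_step f g \<eta> Y u V = ?trial v"
    using False unfolding row_step_def v_def by simp
  note pat = supp_trial_pattern[OF fill False]
  obtain w where w: "\<And>j. V $ u $ j \<noteq> 0 \<Longrightarrow> j = w" using nn_stiefelD(3)[OF V] by metis
  have "prox_model f g \<eta> Y (?trial v) \<le> prox_model f g \<eta> Y (?trial w)"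
    unfolding v_def by (rule first_argmin_le) auto
  also have "\<dots> \<le> prox_model f g \<eta> Y V"
    by (rule supp_proj_minimises[OF pat V])
      (use w fill in \<open>auto simp: supp_trial_entry[OF V] fills_zero_rows_def\<close>)
  finally show thesis using trial[OF pat] step by metis
qed

lemma row_step_descent:
  fixes Y V :: "('n::{finite,linorder}, 'p::{finite,linorder}) rmat"
  assumes fill: "fills_zero_rows g Y V" and u: "u \<notin> zrow Y"
  shows "fills_zero_rows g Y (row_step f g \<eta> Y u V)"
    and "prox_model f g \<eta> Y (row_step f g \<eta> Y u V) \<le> prox_model f g \<eta> Y V"
proof -
  have V: "V \<in> nn_stiefel" using fill by (simp add: fills_zero_rows_def)
  show "fills_zero_rows g Y (row_step f g \<eta> Y u V)"
  using fill
  proof (cases rule: row_step_cases[where u = u and f = f and \<eta> = \<eta>])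
    case (trial v)
    have "j = row_argmin g Y i" if "i \<in> zrow Y" "row_step f g \<eta> Y u V $ i $ j \<noteq> 0" for i j
    proof -
      have "supp_trial g Y V u v $ i $ j = 1" using supp_proj_supp[OF trial(1)] that(2) unfolding trial(2) .
      then show ?thesis using that(1) u by (auto simp: supp_trial_entry[OF V] split: if_splits)
    qed
    then show ?thesis
      using supp_proj_in_nn_stiefel[OF trial(1), of g \<eta> Y] trial(2) by (simp add: fills_zero_rows_def)
  qed (use fill in simp)
  show "prox_model f g \<eta> Y (row_step f g \<eta> Y u V) \<le> prox_model f g \<eta> Y V"
    using fill
    by (cases rule: row_step_cases[where u = u and f = f and \<eta> = \<eta>]) auto
qed

lemma fold_row_step_descent:
  fixes Y V :: "('n::{finite,linorder}, 'p::{finite,linorder}) rmat"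
  assumes "fills_zero_rows g Y V" and "set us \<inter> zrow Y = {}"
  shows "fold (row_step f g \<eta> Y) us V \<in> nn_stiefel
    \<and> prox_model f g \<eta> Y (fold (row_step f g \<eta> Y) us V) \<le> prox_model f g \<eta> Y V"
  using assms
proof (induction us arbitrary: V)
  case Nil
  then show ?case by (simp add: fills_zero_rows_def)
next
  case (Cons u us)
  then show ?case using row_step_descent[of g Y V u f \<eta>] by (auto intro: order_trans)
qed

text \<open>
  Only the last projection matters: in the second alternative \<open>S\<close> is the support used there, and it
  offers every zero row of \<open>Y\<close> its column of smallest gradient.
\<close>

lemma fold_row_step_cases:
  fixes Y V :: "('n::{finite,linorder}, 'p::{finite,linorder}) rmat"
  assumes "fills_zero_rows g Y V" and "set us \<inter> zrow Y = {}"
  shows "(fold (row_step f g \<eta> Y) us V = V \<and> (\<forall>u\<in>set us. \<exists>j. V $ u $ j = 1)) \<or>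
    (\<exists>S. sign_pattern S \<and> (\<forall>i\<in>zrow Y. S $ i $ row_argmin g Y i = 1)
       \<and> fold (row_step f g \<eta> Y) us V = supp_proj g \<eta> Y S)"
  using assms
proof (induction us arbitrary: V)
  case (Cons u us)
  let ?V = "row_step f g \<eta> Y u V"
  have IH: "(fold (row_step f g \<eta> Y) us ?V = ?V \<and> (\<forall>u\<in>set us. \<exists>j. ?V $ u $ j = 1)) \<or>
    (\<exists>S. sign_pattern S \<and> (\<forall>i\<in>zrow Y. S $ i $ row_argmin g Y i = 1)
       \<and> fold (row_step f g \<eta> Y) us ?V = supp_proj g \<eta> Y S)"
    using Cons row_step_descent(1)[of g Y V u f \<eta>] by auto
  show ?case
  using Cons.prems(1)
  proof (cases rule: row_step_cases[where u = u and f = f and \<eta> = \<eta>])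
    case (keep j)
    then show ?thesis using IH by auto
  next
    case (trial v)
    have "V \<in> nn_stiefel" using Cons.prems by (simp add: fills_zero_rows_def)
    moreover have "i \<noteq> u" if "i \<in> zrow Y" for i using Cons.prems that by auto
    ultimately have "\<forall>i\<in>zrow Y. supp_trial g Y V u v $ i $ row_argmin g Y i = 1"
      by (simp add: supp_trial_entry)
    then show ?thesis using IH trial by auto
  qed
qed simp

section \<open>Optimality conditions of the projection\<close>

lemma row_argmin_le: "g Z $ i $ row_argmin g Z i \<le> g Z $ i $ j"
  unfolding row_argmin_def by (rule first_argmin_le) auto

text \<open>
  At an entry where \<open>Z\<close> vanishes but the support allows mass, the projection is the positive part of
  \<open>- g Z\<close> divided by the normalising factor. So a negative gradient entry is visible as an entry of
  the projection of proportional size.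
\<close>

lemma supp_proj_zero_row:
  fixes Z S :: "('n::{finite,linorder}, 'p::finite) rmat"
  assumes S: "sign_pattern S" and "S $ i $ j = 1" and "Z $ i $ j = 0"
  shows "- g Z $ i $ j \<le> norm (\<eta> *\<^sub>R Z - g Z) * supp_proj g \<eta> Z S $ i $ j"
using S
proof (cases rule: supp_proj_column_cases[where \<eta> = \<eta> and Z = Z and g = g and j = j])
  case (normalised c)
  have "- g Z $ i $ j \<le> c * supp_proj g \<eta> Z S $ i $ j" using assms normalised by simp
  also have "\<dots> \<le> norm (\<eta> *\<^sub>R Z - g Z) * supp_proj g \<eta> Z S $ i $ j"
    using normalised(2) nn_stiefelD(1)[OF supp_proj_in_nn_stiefel[OF S]] by (rule mult_right_mono)
  finally show ?thesis .
next
  case (unit i0)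
  then have "- g Z $ i $ j \<le> 0" using unit(1)[of i] assms by (simp add: max_def split: if_splits)
  also have "\<dots> \<le> norm (\<eta> *\<^sub>R Z - g Z) * supp_proj g \<eta> Z S $ i $ j"
    using nn_stiefelD(1)[OF supp_proj_in_nn_stiefel[OF S]] by simp
  finally show ?thesis .
qed

lemma grad_proj_entry:
  fixes Y :: "('n::finite, 'p::finite) rmat"
  shows "grad_proj g Y $ i $ j = g Y $ i $ j - Y $ i $ j * (\<Sum>k\<in>UNIV. Y $ k $ j * g Y $ k $ j)"
  unfolding grad_proj_def Diag_def
  by (simp add: matrix_matrix_mult_def transpose_def if_distrib cong: if_cong)

text \<open>
  Optimality of the projection says that, on the support of \<open>Y\<close>, each column of \<open>g Z + \<eta> (Y - Z)\<close> is
  a multiple of the same column of \<open>Y\<close>, so its projection as in \<^const>\<open>grad_proj\<close> vanishes there. Replacing it by \<open>g Y\<close> introduces the error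
  \<open>H\<close> of size at most \<open>(L + \<eta>) * norm (Y - Z)\<close>, and passing to the projected gradient at most
  doubles it.
\<close>

lemma supp_proj_stationary_on_support:
  fixes Z S :: "('n::{finite,linorder}, 'p::finite) rmat"
    and g :: "('n, 'p) rmat \<Rightarrow> ('n, 'p) rmat" and \<eta> :: real
  assumes S: "sign_pattern S" and "0 \<le> \<eta>"
  defines "Y \<equiv> supp_proj g \<eta> Z S"
  assumes lip: "norm (g Y - g Z) \<le> L * norm (Y - Z)" and nz: "Y $ i $ j \<noteq> 0"
  shows "\<bar>grad_proj g Y $ i $ j\<bar> \<le> 2 * (L + \<eta>) * norm (Y - Z)"
proof -
  have Y: "Y \<in> nn_stiefel" unfolding Y_def by (rule supp_proj_in_nn_stiefel[OF S])
  have L: "0 \<le> L * norm (Y - Z)" using lip norm_ge_zero order_trans by blast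
  show ?thesis
  using S
  proof (cases rule: supp_proj_column_cases[where \<eta> = \<eta> and Z = Z and g = g and j = j])
    case (normalised c)
    define H where "H = (g Y - g Z) - \<eta> *\<^sub>R (Y - Z)"
    have H: "norm H \<le> (L + \<eta>) * norm (Y - Z)"
      using norm_triangle_ineq4[of "g Y - g Z" "\<eta> *\<^sub>R (Y - Z)"] lip \<open>0 \<le> \<eta>\<close>
      by (simp add: H_def distrib_right)
    have on_supp: "g Y $ k $ j = H $ k $ j + (\<eta> - c) * Y $ k $ j" if "Y $ k $ j \<noteq> 0" for k
    proof -
      have "S $ k $ j = 1" using supp_proj_supp[OF S] that unfolding Y_def .
      moreover have "c * Y $ k $ j = max 0 ((\<eta> * Z $ k $ j - g Z $ k $ j) * S $ k $ j)"
        using normalised unfolding Y_def by simp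
      moreover have "c * Y $ k $ j \<noteq> 0" using that normalised(1) by simp
      ultimately have "c * Y $ k $ j = \<eta> * Z $ k $ j - g Z $ k $ j"
        by (simp add: max_def split: if_splits)
      then show ?thesis by (simp add: H_def algebra_simps)
    qed
    have "Y $ k $ j * g Y $ k $ j = Y $ k $ j * H $ k $ j + (\<eta> - c) * (Y $ k $ j)\<^sup>2" for k
    proof (cases "Y $ k $ j = 0")
      case False
      show ?thesis unfolding on_supp[OF False] by (simp add: algebra_simps power2_eq_square)
    qed simp
    then have sum_eq: "(\<Sum>k\<in>UNIV. Y $ k $ j * g Y $ k $ j) = column j Y \<bullet> column j H + (\<eta> - c)"
      using nn_stiefelD(2)[OF Y, of j]
      by (simp add: sum.distrib inner_vec_def column_def flip: sum_distrib_left)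
    have "grad_proj g Y $ i $ j = H $ i $ j - Y $ i $ j * (column j Y \<bullet> column j H)"
      unfolding grad_proj_entry sum_eq using on_supp[OF nz] by (simp add: algebra_simps)
    also have "\<bar>\<dots>\<bar> \<le> \<bar>H $ i $ j\<bar> + \<bar>Y $ i $ j\<bar> * \<bar>column j Y \<bullet> column j H\<bar>"
      by (metis abs_mult abs_triangle_ineq4)
    also have "\<dots> \<le> norm H + 1 * (1 * norm H)"
    proof (intro add_mono mult_mono)
      have "(norm (column j Y))\<^sup>2 = 1" unfolding norm_column_sq by (rule nn_stiefelD(2)[OF Y])
      then have "norm (column j Y) = 1"
        using norm_ge_zero[of "column j Y"] by (auto simp: power2_eq_1_iff simp del: norm_ge_zero)
      then show "\<bar>column j Y \<bullet> column j H\<bar> \<le> 1 * norm H"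
        using Cauchy_Schwarz_ineq2[of "column j Y" "column j H"] norm_column_le[of j H] by simp
    qed (use nn_stiefelD(1)[OF Y] nn_stiefel_le_1[OF Y] abs_entry_le_norm in auto)
    finally show ?thesis using H by (simp add: algebra_simps)
  next
    case (unit i0)
    have "\<bar>grad_proj g Y $ i $ j\<bar> = 0"
      using nz unit(4) unfolding grad_proj_entry Y_def
      by (simp add: if_distrib[where f = "\<lambda>x. x * _"] cong: if_cong split: if_splits)
    then show ?thesis using L \<open>0 \<le> \<eta>\<close> by (simp add: distrib_right)
  qed
qed

section \<open>Sufficient decrease along the iterates\<close>

locale support_set_run =
  fixes f :: "('n::{finite,linorder}, 'p::{finite,linorder}) rmat \<Rightarrow> real"
    and g :: "('n, 'p) rmat \<Rightarrow> ('n, 'p) rmat"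
    and L \<eta> \<delta> \<theta> :: real
    and X0 :: "('n, 'p) rmat"
    and X Y :: "nat \<Rightarrow> ('n, 'p) rmat"
  assumes grad: "\<And>Z. GDERIV f Z :> g Z"
    and cont: "continuous_on UNIV g"
    and lip: "L-lipschitz_on (convex hull stiefel) g"
    and start: "X0 \<in> nn_stiefel"
    and \<eta>: "\<eta> > L" and \<delta>: "0 < \<delta>" "\<delta> < 1" and \<theta>: "0 < \<theta>"
    and run: "support_set_iterates f g \<eta> \<delta> \<theta> X0 X Y"
begin

lemma L_nonneg: "0 \<le> L"
  using lip by (rule lipschitz_on_nonneg)

lemma gradient_lipschitz:
  assumes "A \<in> nn_stiefel" "B \<in> nn_stiefel"
  shows "norm (g B - g A) \<le> L * norm (B - A)"
proof -
  have "A \<in> convex hull stiefel" "B \<in> convex hull stiefel"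
    using assms by (auto simp: nn_stiefel_def intro: hull_inc)
  then show ?thesis using lipschitz_onD[OF lip] by (simp add: dist_norm)
qed

lemma sufficient_decrease:
  assumes "Z \<in> nn_stiefel" "V \<in> nn_stiefel" and "prox_model f g \<eta> Z V \<le> f Z"
  shows "f V + (\<eta> - L) / 2 * (norm (V - Z))\<^sup>2 \<le> f Z"
proof -
  have "Z \<in> convex hull stiefel" "V \<in> convex hull stiefel"
    using assms by (auto simp: nn_stiefel_def intro: hull_inc)
  then have "f V \<le> f Z + g Z \<bullet> (V - Z) + L / 2 * (norm (V - Z))\<^sup>2"
    by (intro quadratic_upper_bound[OF grad lip convex_convex_hull])
  moreover have "f Z + g Z \<bullet> (V - Z) + \<eta> / 2 * (norm (V - Z))\<^sup>2 \<le> f Z"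
    using assms(3) by (simp only: prox_model_def)
  ultimately show ?thesis by (simp add: left_diff_distrib diff_divide_distrib)
qed

lemma Y_eq: "Y k = supp_proj g \<eta> (X k) (supp_fill g (X k))"
  using run by (simp add: support_set_iterates_def)

lemma X_Suc_cases:
  obtains (far) "\<theta> \<le> norm (Y k - X k)" "X (Suc k) = Y k"
  | (close) us where "norm (Y k - X k) < \<theta>" "set us = small_rows \<delta> (Y k)"
      "X (Suc k) = fold (row_step f g \<eta> (Y k)) us (Y k)"
  using run unfolding support_set_iterates_def by (metis linorder_not_le)

lemma small_rows_nonzero: "small_rows \<delta>' V \<inter> zrow V = {}"
  by (auto simp: small_rows_def zrow_def)

lemma fills_zero_rows_self: "V \<in> nn_stiefel \<Longrightarrow> fills_zero_rows g V V"
  by (simp add: fills_zero_rows_def zrow_def)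

lemma prox_model_self: "prox_model f g \<eta> Z Z = f Z"
  by (simp add: prox_model_def)

lemma iterates_feasible: "X k \<in> nn_stiefel" "Y k \<in> nn_stiefel"
proof -
  have Y: "Y k \<in> nn_stiefel" if "X k \<in> nn_stiefel" for k
    unfolding Y_eq by (rule supp_proj_in_nn_stiefel[OF supp_fill_pattern(1)[OF that]])
  show "X k \<in> nn_stiefel"
  proof (induction k)
    case 0
    then show ?case using run start by (simp add: support_set_iterates_def)
  next
    case (Suc k)
    show ?case
    proof (cases rule: X_Suc_cases[of k])
      case (close us)
      then show ?thesis
        using fold_row_step_descent[OF fills_zero_rows_self[OF Y[OF Suc]], of us f \<eta>] small_rows_nonzero[of \<delta> "Y k"] by simp
    qed (use Y[OF Suc] in simp)
  qed
  then show "Y k \<in> nn_stiefel" by (rule Y)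
qed

lemma decrease:
  "f (Y k) + (\<eta> - L) / 2 * (norm (Y k - X k))\<^sup>2 \<le> f (X k)"
  "f (X (Suc k)) + (\<eta> - L) / 2 * (norm (X (Suc k) - Y k))\<^sup>2 \<le> f (Y k)"
proof -
  note X = iterates_feasible(1)[of k] and Y = iterates_feasible(2)[of k]
  have "prox_model f g \<eta> (X k) (Y k) \<le> prox_model f g \<eta> (X k) (X k)"
    unfolding Y_eq by (rule supp_proj_minimises[OF supp_fill_pattern(1)[OF X] X supp_fill_pattern(2)[OF X]])
  then show "f (Y k) + (\<eta> - L) / 2 * (norm (Y k - X k))\<^sup>2 \<le> f (X k)"
    using sufficient_decrease[OF X Y] by (simp add: prox_model_self)
  have "prox_model f g \<eta> (Y k) (X (Suc k)) \<le> prox_model f g \<eta> (Y k) (Y k)"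
  proof (cases rule: X_Suc_cases[of k])
    case (close us)
    then show ?thesis
      using fold_row_step_descent[OF fills_zero_rows_self[OF Y], of us f \<eta>] small_rows_nonzero[of \<delta> "Y k"] by simp
  qed simp
  then show "f (X (Suc k)) + (\<eta> - L) / 2 * (norm (X (Suc k) - Y k))\<^sup>2 \<le> f (Y k)"
    using sufficient_decrease[OF Y iterates_feasible(1)[of "Suc k"]] by (simp add: prox_model_self)
qed

section \<open>Short steps force approximate stationarity\<close>

text \<open>
  Only rows that are zero in \<open>Y k\<close> but not in \<open>X k\<close> are left to the second assumption. A row that is
  zero in both was offered its column of smallest gradient without receiving mass, so its gradient is
  nonnegative at \<open>X k\<close> and changes by at most the Lipschitz bound.
\<close>

lemma Y_stationary:
  assumes \<epsilon>: "2 * (L + \<eta>) * norm (Y k - X k) \<le> \<epsilon>"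
    and new: "\<And>i j. i \<in> zrow (Y k) \<Longrightarrow> i \<notin> zrow (X k) \<Longrightarrow> - \<epsilon> \<le> g (Y k) $ i $ j"
  shows "approx_stationary g \<epsilon> (Y k)"
proof -
  note X = iterates_feasible(1)[of k] and Y = iterates_feasible(2)[of k]
  note pat = supp_fill_pattern(1)[OF X, of g]
  have "0 \<le> \<eta>" using L_nonneg \<eta> by simp
  have "\<bar>grad_proj g (Y k) $ i $ j\<bar> \<le> \<epsilon>" if "(i, j) \<in> mat_supp (Y k)" for i j
    using supp_proj_stationary_on_support[OF pat \<open>0 \<le> \<eta>\<close>, of g "X k" L i j] \<epsilon>
      gradient_lipschitz[OF X Y] that
    unfolding Y_eq[symmetric] by (simp add: mat_supp_def)
  moreover have "- \<epsilon> \<le> g (Y k) $ i $ j" if i: "i \<in> zrow (Y k)" for i j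
  proof (cases "i \<in> zrow (X k)")
    case True
    let ?j = "row_argmin g (X k) i"
    have "- g (X k) $ i $ ?j \<le> norm (\<eta> *\<^sub>R X k - g (X k)) * Y k $ i $ ?j"
      unfolding Y_eq by (rule supp_proj_zero_row[OF pat]) (use True in \<open>auto simp: zrow_def supp_fill_def\<close>)
    then have "0 \<le> g (X k) $ i $ j" 
      using i row_argmin_le[of g "X k" i j] by (simp add: zrow_def)
    moreover have "\<bar>(g (Y k) - g (X k)) $ i $ j\<bar> \<le> L * norm (Y k - X k)"
      using abs_entry_le_norm gradient_lipschitz[OF X Y] by (rule order_trans)
    moreover have "L * norm (Y k - X k) \<le> 2 * (L + \<eta>) * norm (Y k - X k)"
      using L_nonneg \<eta> by (intro mult_right_mono) auto
    ultimately show ?thesis using \<epsilon> by simp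
  qed (use new i in blast)
  ultimately show ?thesis using Y by (auto simp: approx_stationary_def)
qed

text \<open>
  Without any projection in the inner loop, every small row of \<open>Y k\<close> contains the entry 1, and the
  only nonzero entry of any other nonzero row equals its norm, which exceeds \<open>\<delta>\<close>. With a projection, the row of \<open>X (Suc k)\<close> shows the size of a negative gradient entry.
\<close>

lemma inner_loop_dichotomy:
  assumes "norm (Y k - X k) < \<theta>"
  shows "(\<forall>i\<in>zrow (Y k). \<forall>j. - g (Y k) $ i $ j \<le> norm (\<eta> *\<^sub>R Y k - g (Y k)) * norm (X (Suc k) - Y k)) \<or>
    (\<forall>i j. X (Suc k) $ i $ j \<noteq> 0 \<longrightarrow> \<delta> \<le> X (Suc k) $ i $ j)"
proof (cases rule: X_Suc_cases[of k])
  case (close us)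
  note Y = iterates_feasible(2)[of k]
  have disj: "set us \<inter> zrow (Y k) = {}" using close small_rows_nonzero[of \<delta> "Y k"] by simp
  from fold_row_step_cases[OF fills_zero_rows_self[OF Y] disj, of f \<eta>]
  show ?thesis unfolding close(3)[symmetric]
  proof (elim disjE exE conjE)
    assume same: "X (Suc k) = Y k" and one: "\<forall>u\<in>set us. \<exists>j. Y k $ u $ j = 1"
    have "\<delta> \<le> Y k $ i $ j" if nz: "Y k $ i $ j \<noteq> 0" for i j
    proof (cases "i \<in> small_rows \<delta> (Y k)")
      case True
      then obtain j' where "Y k $ i $ j' = 1" using one close by blast
      then have "j' = j" using nn_stiefelD(3)[OF Y nz, of j'] by simp
      then show ?thesis using \<delta> \<open>Y k $ i $ j' = 1\<close> by simp
    next
      case False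
      have "Y k $ i \<noteq> 0" using nz by auto
      then have "\<delta> < norm (Y k $ i)" using False by (simp add: small_rows_def row_threshold_def)
      moreover have "Y k $ i = axis j (Y k $ i $ j)"
        using nn_stiefelD(3)[OF Y nz] by (auto simp: vec_eq_iff axis_def)
      then have "norm (Y k $ i) = Y k $ i $ j"
        using nn_stiefelD(1)[OF Y, of i j] by (metis abs_of_nonneg norm_axis_real)
      ultimately show ?thesis by simp
    qed
    then show ?thesis unfolding same by blast
  next
    fix S
    assume S: "sign_pattern S" and one: "\<forall>i\<in>zrow (Y k). S $ i $ row_argmin g (Y k) i = 1"
      and X': "X (Suc k) = supp_proj g \<eta> (Y k) S"
    have "- g (Y k) $ i $ j \<le> norm (\<eta> *\<^sub>R Y k - g (Y k)) * norm (X (Suc k) - Y k)"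
      if i: "i \<in> zrow (Y k)" for i j
    proof -
      let ?j = "row_argmin g (Y k) i"
      have "- g (Y k) $ i $ j \<le> - g (Y k) $ i $ ?j" using row_argmin_le[of g "Y k" i j] by simp
      also have "\<dots> \<le> norm (\<eta> *\<^sub>R Y k - g (Y k)) * X (Suc k) $ i $ ?j"
        unfolding X' by (rule supp_proj_zero_row[OF S]) (use one i in \<open>auto simp: zrow_def\<close>)
      also have "X (Suc k) $ i $ ?j \<le> norm (X (Suc k) - Y k)"
        using abs_entry_le_norm[of "X (Suc k) - Y k" i ?j] i by (simp add: zrow_def)
      finally show ?thesis by (simp add: mult_left_mono)
    qed
    then show ?thesis by blast
  qed
qed (use assms in simp)

text \<open>
  In the first case of the dichotomy \<open>Y k\<close> is stationary; in the second the step after it is, because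
  a row with an entry of size \<open>\<delta>\<close> cannot become zero in a step shorter than \<open>\<delta>\<close>.
\<close>

lemma small_steps_stationary:
  assumes \<rho>: "\<rho> \<le> \<theta>" "\<rho> \<le> \<delta>" "2 * (L + \<eta>) * \<rho> \<le> \<epsilon>"
    and M: "norm (\<eta> *\<^sub>R Y k - g (Y k)) \<le> M" "M * \<rho> \<le> \<epsilon>"
    and small: "norm (Y k - X k) < \<rho>" "norm (X (Suc k) - Y k) < \<rho>" "norm (Y (Suc k) - X (Suc k)) < \<rho>"
  shows "approx_stationary g \<epsilon> (Y k) \<or> approx_stationary g \<epsilon> (Y (Suc k))"
proof -
  have pos: "0 \<le> 2 * (L + \<eta>)" using L_nonneg \<eta> by simp
  have le: "2 * (L + \<eta>) * d \<le> \<epsilon>" if "d < \<rho>" for d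
    using mult_left_mono[OF less_imp_le[OF that] pos] \<rho>(3) by simp
  have "norm (Y k - X k) < \<theta>" using small \<rho> by simp
  from inner_loop_dichotomy[OF this] show ?thesis
  proof
    assume "\<forall>i\<in>zrow (Y k). \<forall>j. - g (Y k) $ i $ j \<le> norm (\<eta> *\<^sub>R Y k - g (Y k)) * norm (X (Suc k) - Y k)"
    moreover have "norm (\<eta> *\<^sub>R Y k - g (Y k)) * norm (X (Suc k) - Y k) \<le> M * \<rho>"
      using M(1) small(2) by (intro mult_mono) (auto intro: order_trans[OF norm_ge_zero])
    ultimately have "\<forall>i\<in>zrow (Y k). \<forall>j. - \<epsilon> \<le> g (Y k) $ i $ j"
      using M(2) by (smt (verit, best))
    then show ?thesis using Y_stationary[OF le[OF small(1)]] by blast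
  next
    assume large: "\<forall>i j. X (Suc k) $ i $ j \<noteq> 0 \<longrightarrow> \<delta> \<le> X (Suc k) $ i $ j"
    have "i \<in> zrow (X (Suc k))" if i: "i \<in> zrow (Y (Suc k))" for i
    proof (rule ccontr)
      assume "i \<notin> zrow (X (Suc k))"
      then obtain j where "\<delta> \<le> X (Suc k) $ i $ j" using large by (auto simp: zrow_def vec_eq_iff)
      also have "\<dots> \<le> norm (Y (Suc k) - X (Suc k))"
        using abs_entry_le_norm[of "Y (Suc k) - X (Suc k)" i j] i by (simp add: zrow_def)
      finally show False using small(3) \<rho>(2) by simp
    qed
    then show ?thesis using Y_stationary[OF le[OF small(3)]] by blast
  qed
qed

section \<open>Counting iterations\<close>

lemma bounds_on_nn_stiefel:
  obtains m M where "\<And>Z. Z \<in> nn_stiefel \<Longrightarrow> m \<le> f Z"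
    "0 < M" "\<And>Z. Z \<in> nn_stiefel \<Longrightarrow> norm (\<eta> *\<^sub>R Z - g Z) \<le> M"
proof -
  let ?K = "cball 0 (sqrt CARD('p)) :: ('n, 'p) rmat set"
  have sub: "Z \<in> ?K" if "Z \<in> nn_stiefel" for Z
    using nn_stiefel_norm_sq[OF that] by (simp add: real_le_rsqrt)
  have "continuous_on ?K f"
    using grad by (auto intro!: continuous_at_imp_continuous_on has_derivative_continuous simp: gderiv_def)
  then have "bounded (f ` ?K)" by (intro compact_imp_bounded compact_continuous_image) auto
  then obtain m where m: "\<And>Z. Z \<in> ?K \<Longrightarrow> \<bar>f Z\<bar> \<le> m"
    unfolding bounded_iff by (metis imageI real_norm_def)
  have "continuous_on ?K (\<lambda>Z. \<eta> *\<^sub>R Z - g Z)"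
    using cont by (intro continuous_intros) (auto intro: continuous_on_subset)
  then have "bounded ((\<lambda>Z. \<eta> *\<^sub>R Z - g Z) ` ?K)" by (intro compact_imp_bounded compact_continuous_image) auto
  then obtain M where "0 < M" and M: "\<And>Z. Z \<in> ?K \<Longrightarrow> norm (\<eta> *\<^sub>R Z - g Z) \<le> M"
    unfolding bounded_pos by auto
  show thesis
    by (rule that[of "- m" M]) (use m M \<open>0 < M\<close> sub in \<open>auto simp: abs_le_iff minus_le_iff\<close>)
qed

lemma square_summable_steps:
  obtains B where "0 \<le> B" "\<And>N. (\<Sum>k<N. (norm (Y k - X k))\<^sup>2 + (norm (X (Suc k) - Y k))\<^sup>2) \<le> B"
proof -
  obtain m where m: "\<And>Z. Z \<in> nn_stiefel \<Longrightarrow> m \<le> f Z" using bounds_on_nn_stiefel by metis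
  let ?T = "\<lambda>k. (norm (Y k - X k))\<^sup>2 + (norm (X (Suc k) - Y k))\<^sup>2"
  define a where "a = (\<eta> - L) / 2"
  have "0 < a" using \<eta> by (simp add: a_def)
  have "a * ?T k \<le> f (X k) - f (X (Suc k))" for k
    using decrease[of k] by (simp add: distrib_left a_def)
  then have "a * (\<Sum>k<N. ?T k) \<le> (\<Sum>k<N. f (X k) - f (X (Suc k)))" for N
    unfolding sum_distrib_left by (rule sum_mono)
  also have "(\<Sum>k<N. f (X k) - f (X (Suc k))) = f (X 0) - f (X N)" for N
    by (rule sum_lessThan_telescope')
  also have "f (X 0) - f (X N) \<le> f (X 0) - m" for N
    using m[OF iterates_feasible(1)[of N]] by simp
  finally have "(\<Sum>k<N. ?T k) \<le> (f (X 0) - m) / a" for N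
    using \<open>0 < a\<close> by (simp add: pos_le_divide_eq mult.commute)
  moreover have "0 \<le> (f (X 0) - m) / a" using m[OF iterates_feasible(1)[of 0]] \<open>0 < a\<close> by simp
  ultimately show thesis using that by blast
qed

text \<open>
  Three consecutive step lengths have to be small at once, so the pigeonhole argument is applied to
  sums over two neighbouring iterations, which costs a factor 2.
\<close>

lemma consecutive_small_steps:
  obtains B where "0 \<le> B" "\<And>\<rho>. 0 < \<rho> \<Longrightarrow>
    \<exists>k. real k \<le> B / \<rho>\<^sup>2 \<and> norm (Y k - X k) < \<rho> \<and> norm (X (Suc k) - Y k) < \<rho> \<and> norm (Y (Suc k) - X (Suc k)) < \<rho>"
proof -
  obtain B where B: "0 \<le> B" "\<And>N. (\<Sum>k<N. (norm (Y k - X k))\<^sup>2 + (norm (X (Suc k) - Y k))\<^sup>2) \<le> B"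
    using square_summable_steps by blast
  let ?T = "\<lambda>k. (norm (Y k - X k))\<^sup>2 + (norm (X (Suc k) - Y k))\<^sup>2"
  have "\<exists>k. real k \<le> 2 * B / \<rho>\<^sup>2 \<and> norm (Y k - X k) < \<rho> \<and> norm (X (Suc k) - Y k) < \<rho> \<and> norm (Y (Suc k) - X (Suc k)) < \<rho>"
    if "0 < \<rho>" for \<rho>
  proof -
    define N where "N = Suc (nat \<lfloor>2 * B / \<rho>\<^sup>2\<rfloor>)"
    have pos: "0 \<le> 2 * B / \<rho>\<^sup>2" using B(1) by simp
    have "\<exists>k<N. ?T k + ?T (Suc k) < \<rho>\<^sup>2"
    proof (rule ccontr)
      assume "\<not> ?thesis"
      then have "\<rho>\<^sup>2 \<le> ?T k + ?T (Suc k)" if "k < N" for k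
        using that by (meson not_less)
      then have "(\<Sum>k<N. \<rho>\<^sup>2) \<le> (\<Sum>k<N. ?T k + ?T (Suc k))" by (intro sum_mono) simp
      also have "\<dots> = (\<Sum>k<N. ?T k) + (\<Sum>k<N. ?T (Suc k))" by (rule sum.distrib)
      also have "(\<Sum>k<N. ?T (Suc k)) \<le> (\<Sum>k<Suc N. ?T k)"
        by (subst sum.lessThan_Suc_shift) simp
      finally have "real N * \<rho>\<^sup>2 \<le> 2 * B" using B(2)[of N] B(2)[of "Suc N"] by simp
      then have "real N \<le> 2 * B / \<rho>\<^sup>2" using that by (simp add: pos_le_divide_eq)
      then show False using pos unfolding N_def by linarith
    qed
    then obtain k where "k < N" and k: "?T k + ?T (Suc k) < \<rho>\<^sup>2" by blast
    have lt: "x < \<rho>" if "x\<^sup>2 < \<rho>\<^sup>2" for x using that \<open>0 < \<rho>\<close> by (simp add: power2_less_imp_less)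
    have "(norm (Y k - X k))\<^sup>2 < \<rho>\<^sup>2" "(norm (X (Suc k) - Y k))\<^sup>2 < \<rho>\<^sup>2" "(norm (Y (Suc k) - X (Suc k)))\<^sup>2 < \<rho>\<^sup>2"
      using k zero_le_power2[of "norm (Y k - X k)"] zero_le_power2[of "norm (X (Suc k) - Y k)"]
        zero_le_power2[of "norm (Y (Suc k) - X (Suc k))"] zero_le_power2[of "norm (X (Suc (Suc k)) - Y (Suc k))"]
      by linarith+
    moreover have "real k \<le> 2 * B / \<rho>\<^sup>2" using \<open>k < N\<close> pos unfolding N_def by linarith
    ultimately show ?thesis using lt by blast
  qed
  then show thesis using that[of "2 * B"] B(1) by simp
qed

text \<open>
  The radius \<open>c * \<epsilon>\<close> is chosen below \<open>\<theta>\<close> and \<open>\<delta>\<close> and such that the factors \<open>2 * (L + \<eta>)\<close> and \<open>M\<close>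
  in front of the step lengths are absorbed into \<open>\<epsilon>\<close>. The summand 1 in the constant pays for the
  index shift when it is \<open>Y (Suc k)\<close> that is stationary.
\<close>

lemma complexity:
  "\<exists>C>0. \<forall>\<epsilon>. 0 < \<epsilon> \<and> \<epsilon> < 1 \<longrightarrow> (\<exists>k. real k \<le> C / \<epsilon>\<^sup>2 \<and> approx_stationary g \<epsilon> (Y k))"
proof -
  obtain M where M: "0 < M" "\<And>Z. Z \<in> nn_stiefel \<Longrightarrow> norm (\<eta> *\<^sub>R Z - g Z) \<le> M"
    using bounds_on_nn_stiefel by metis
  obtain B where B: "0 \<le> B" "\<And>\<rho>. 0 < \<rho> \<Longrightarrow>
    \<exists>k. real k \<le> B / \<rho>\<^sup>2 \<and> norm (Y k - X k) < \<rho> \<and> norm (X (Suc k) - Y k) < \<rho> \<and> norm (Y (Suc k) - X (Suc k)) < \<rho>"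
    using consecutive_small_steps by blast
  define K where "K = 2 * (L + \<eta>) + M"
  have K: "0 < K" "2 * (L + \<eta>) \<le> K" "M \<le> K" using L_nonneg \<eta> M(1) by (auto simp: K_def)
  define c where "c = min (min \<theta> \<delta>) (1 / K)"
  have c: "0 < c" "c \<le> \<theta>" "c \<le> \<delta>" "c \<le> 1 / K" using \<theta> \<delta> K(1) by (auto simp: c_def)
  show ?thesis
  proof (intro exI[of _ "B / c\<^sup>2 + 1"] conjI allI impI)
    show "0 < B / c\<^sup>2 + 1" using B(1) by (simp add: add_nonneg_pos)
    fix \<epsilon> :: real
    assume \<epsilon>: "0 < \<epsilon> \<and> \<epsilon> < 1"
    have \<rho>: "c * \<epsilon> \<le> \<theta>" "c * \<epsilon> \<le> \<delta>"
      using c \<epsilon> mult_left_le[of \<epsilon> c] by linarith+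
    have scale: "a * (c * \<epsilon>) \<le> \<epsilon>" if "a \<le> K" for a
    proof -
      have "a * c \<le> K * c" using that c(1) by simp
      also have "\<dots> \<le> 1" using c(4) K(1) by (simp add: field_simps)
      finally show ?thesis using \<epsilon> by (simp flip: mult.assoc)
    qed
    obtain k where k: "real k \<le> B / (c * \<epsilon>)\<^sup>2" and small: "norm (Y k - X k) < c * \<epsilon>"
      "norm (X (Suc k) - Y k) < c * \<epsilon>" "norm (Y (Suc k) - X (Suc k)) < c * \<epsilon>"
      using B(2)[of "c * \<epsilon>"] c(1) \<epsilon> by auto
    have "approx_stationary g \<epsilon> (Y k) \<or> approx_stationary g \<epsilon> (Y (Suc k))"
      by (rule small_steps_stationary[OF \<rho> scale[OF K(2)] M(2)[OF iterates_feasible(2)] scale[OF K(3)] small])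
    moreover have "real (Suc k) \<le> (B / c\<^sup>2 + 1) / \<epsilon>\<^sup>2"
    proof -
      have "1 \<le> 1 / \<epsilon>\<^sup>2" using \<epsilon> by (simp add: power_le_one)
      then have "real (Suc k) \<le> B / (c * \<epsilon>)\<^sup>2 + 1 / \<epsilon>\<^sup>2" using k by simp
      also have "\<dots> = (B / c\<^sup>2 + 1) / \<epsilon>\<^sup>2" by (simp add: add_divide_distrib power_mult_distrib)
      finally show ?thesis .
    qed
    ultimately show "\<exists>k. real k \<le> (B / c\<^sup>2 + 1) / \<epsilon>\<^sup>2 \<and> approx_stationary g \<epsilon> (Y k)"
      by (metis le_add_same_cancel1 of_nat_Suc order_trans zero_le_one add.commute)
  qed
qed

end

theorem theorem5p5:
  fixes f :: "('n::{finite,linorder}, 'p::{finite,linorder}) rmat \<Rightarrow> real"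
    and g :: "('n, 'p) rmat \<Rightarrow> ('n, 'p) rmat"
    and L \<eta> \<delta> \<theta> :: real
    and X0 :: "('n, 'p) rmat"
    and X Y :: "nat \<Rightarrow> ('n, 'p) rmat"
  assumes "1 < CARD('p)" and "CARD('p) < CARD('n)"
    and "\<And>Z. GDERIV f Z :> g Z" and "continuous_on UNIV g"
    and "L-lipschitz_on (convex hull stiefel) g"
    and "X0 \<in> nn_stiefel" and "\<eta> > L" and "0 < \<delta>" and "\<delta> < 1" and "0 < \<theta>"
    and "support_set_iterates f g \<eta> \<delta> \<theta> X0 X Y"
  shows "\<exists>C>0. \<forall>\<epsilon>. 0 < \<epsilon> \<and> \<epsilon> < 1 \<longrightarrow>
           (\<exists>k. real k \<le> C / \<epsilon>\<^sup>2 \<and> approx_stationary g \<epsilon> (Y k))"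
proof -
  interpret support_set_run f g L \<eta> \<delta> \<theta> X0 X Y
    by unfold_locales (use assms(3-) in auto)
  show ?thesis by (rule complexity)
qed

end
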